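(* Let $(A,R,S)$ be a Rota-Baxter system over a field $\mathbb{K}$. Then the $\mathbb{K}$-linear map $$T:A\otimes A\to A\otimes A,\qquad a\otimes b\mapsto R(a)\otimes b+a\otimes S(b),$$ is a weak pseudotwistor.
   Context: Algebras are associative, not necessarily unital, over a field $\mathbb{K}$; $\otimes=\otimes_{\mathbb{K}}$. A Rota-Baxter system is a triple $(A,R,S)$ consisting of an algebra $A$ and two $\mathbb{K}$-linear operators $R,S:A\to A$ such that, for all $a,b\in A$, $$R(a)R(b)=R\big(R(a)b+aS(b)\big),\qquad S(a)S(b)=S\big(R(a)b+aS(b)\big).$$ Let $A$ be an algebra with associative product $\mu:A\otimes A\to A$. A $\mathbb{K}$-linear map $T:A\otimes A\to A\otimes A$ is a weak pseudotwistor if there exists a $\mathbb{K}$-linear map $\mathcal{T}:A\otimes A\otimes A\to A\otimes A\otimes A$ (called a weak companion of $T$) such that $$T\circ(\mathrm{id}\otimes\mu)\circ(\mathrm{id}\otimes T)=(\mathrm{id}\otimes\mu)\circ\mathcal{T},\qquad T\circ(\mu\otimes\mathrm{id})\circ(T\otimes\mathrm{id})=(\mu\otimes\mathrm{id})\circ\mathcal{T}.$$ *)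

theory Defs
  imports "HOL-Algebra.Module" "HOL-Algebra.Free_Abelian_Groups"
begin

section \<open>Linear and bilinear maps\<close>

definition linear_maps ::
  "('k, 'r) ring_scheme \<Rightarrow> ('k, 'a, 'p) module_scheme \<Rightarrow> ('k, 'b, 'q) module_scheme \<Rightarrow> ('a \<Rightarrow> 'b) set"
  where
  "linear_maps K M N =
     {f \<in> carrier M \<rightarrow> carrier N.
        (\<forall>x\<in>carrier M. \<forall>y\<in>carrier M. f (x \<oplus>\<^bsub>M\<^esub> y) = f x \<oplus>\<^bsub>N\<^esub> f y) \<and>
        (\<forall>c\<in>carrier K. \<forall>x\<in>carrier M. f (c \<odot>\<^bsub>M\<^esub> x) = c \<odot>\<^bsub>N\<^esub> f x)}"

definition bilinear_maps ::
  "('k, 'r) ring_scheme \<Rightarrow> ('k, 'a, 'p) module_scheme \<Rightarrow> ('k, 'b, 'q) module_scheme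
    \<Rightarrow> ('k, 'c, 's) module_scheme \<Rightarrow> ('a \<Rightarrow> 'b \<Rightarrow> 'c) set"
  where
  "bilinear_maps K M N P =
     {f. (\<forall>m\<in>carrier M. f m \<in> linear_maps K N P) \<and>
         (\<forall>n\<in>carrier N. (\<lambda>m. f m n) \<in> linear_maps K M P)}"

section \<open>The tensor product of two modules\<close>

text \<open>
  The tensor product is the quotient of the free abelian group on \<open>carrier M \<times> carrier N\<close>
  by the usual biadditivity relations together with \<open>(c m, n) = (m, c n)\<close>.  Its scalar
  multiplication is induced by \<open>(m, n) \<mapsto> (c m, n)\<close>.
\<close>

definition tensor_relations ::
  "('k, 'r) ring_scheme \<Rightarrow> ('k, 'a, 'p) module_scheme \<Rightarrow> ('k, 'b, 'q) module_scheme
    \<Rightarrow> ('a \<times> 'b \<Rightarrow>\<^sub>0 int) set"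
  where
  "tensor_relations K M N =
     {frag_of (m \<oplus>\<^bsub>M\<^esub> m', n) - frag_of (m, n) - frag_of (m', n) | m m' n.
        m \<in> carrier M \<and> m' \<in> carrier M \<and> n \<in> carrier N} \<union>
     {frag_of (m, n \<oplus>\<^bsub>N\<^esub> n') - frag_of (m, n) - frag_of (m, n') | m n n'.
        m \<in> carrier M \<and> n \<in> carrier N \<and> n' \<in> carrier N} \<union>
     {frag_of (c \<odot>\<^bsub>M\<^esub> m, n) - frag_of (m, c \<odot>\<^bsub>N\<^esub> n) | c m n.
        c \<in> carrier K \<and> m \<in> carrier M \<and> n \<in> carrier N}"

definition tensor_null ::
  "('k, 'r) ring_scheme \<Rightarrow> ('k, 'a, 'p) module_scheme \<Rightarrow> ('k, 'b, 'q) module_scheme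
    \<Rightarrow> ('a \<times> 'b \<Rightarrow>\<^sub>0 int) set"
  where
  "tensor_null K M N =
     generate (free_Abelian_group (carrier M \<times> carrier N)) (tensor_relations K M N)"

text \<open>
  The record type \<open>module\<close> extends \<open>ring\<close>, so the fields \<open>mult\<close> and \<open>one\<close> must be filled;
  they are irrelevant for the module structure.
\<close>

definition tensor_product ::
  "('k, 'r) ring_scheme \<Rightarrow> ('k, 'a, 'p) module_scheme \<Rightarrow> ('k, 'b, 'q) module_scheme
    \<Rightarrow> ('k, ('a \<times> 'b \<Rightarrow>\<^sub>0 int) set) module"
  where
  "tensor_product K M N =
     (let F = free_Abelian_group (carrier M \<times> carrier N);
          H = tensor_null K M N
      in \<lparr>carrier = carrier (F Mod H),
          monoid.mult = undefined, one = undefined,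
          ring.zero = \<one>\<^bsub>F Mod H\<^esub>,
          ring.add = monoid.mult (F Mod H),
          smult = (\<lambda>c X. H <#>\<^bsub>F\<^esub> (frag_extend (\<lambda>(m, n). frag_of (c \<odot>\<^bsub>M\<^esub> m, n)) ` X))\<rparr>)"

definition tensor ::
  "('k, 'r) ring_scheme \<Rightarrow> ('k, 'a, 'p) module_scheme \<Rightarrow> ('k, 'b, 'q) module_scheme
    \<Rightarrow> 'a \<Rightarrow> 'b \<Rightarrow> ('a \<times> 'b \<Rightarrow>\<^sub>0 int) set"
  where
  "tensor K M N m n =
     tensor_null K M N #>\<^bsub>free_Abelian_group (carrier M \<times> carrier N)\<^esub> frag_of (m, n)"

text \<open>
  The linear map determined by its values \<open>f m n\<close> on the elementary tensors
  (it is made \<open>undefined\<close> outside the carrier, so that it is unique as a HOL function).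
  Existence and uniqueness for bilinear \<open>f\<close> is \<open>tensor_lift_unique_existence\<close> below.
\<close>

definition tensor_lift ::
  "('k, 'r) ring_scheme \<Rightarrow> ('k, 'a, 'p) module_scheme \<Rightarrow> ('k, 'b, 'q) module_scheme
    \<Rightarrow> ('k, 'c, 's) module_scheme \<Rightarrow> ('a \<Rightarrow> 'b \<Rightarrow> 'c) \<Rightarrow> ('a \<times> 'b \<Rightarrow>\<^sub>0 int) set \<Rightarrow> 'c"
  where
  "tensor_lift K M N P f =
     (THE h. h \<in> linear_maps K (tensor_product K M N) P \<and>
             h \<in> extensional (carrier (tensor_product K M N)) \<and>
             (\<forall>m\<in>carrier M. \<forall>n\<in>carrier N. h (tensor K M N m n) = f m n))"

locale two_modules = M: module K M + N: module K N for K (structure) and M and N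
begin

abbreviation "F \<equiv> free_Abelian_group (carrier M \<times> carrier N)"
abbreviation "H \<equiv> tensor_null K M N"
abbreviation "T \<equiv> tensor_product K M N"
abbreviation "t \<equiv> tensor K M N"
abbreviation "scale c \<equiv> frag_extend (\<lambda>(m, n). frag_of (c \<odot>\<^bsub>M\<^esub> m, n))"

sublocale F: comm_group F
  by (rule abelian_free_Abelian_group)

lemma diffF: "a \<in> carrier F \<Longrightarrow> b \<in> carrier F \<Longrightarrow> a - b \<in> carrier F"
  unfolding carrier_free_Abelian_group_iff by (rule order_trans[OF keys_diff Un_least])

lemma inF: "m \<in> carrier M \<Longrightarrow> n \<in> carrier N \<Longrightarrow> frag_of (m, n) \<in> carrier F"
  by (simp add: keys_frag_of)

lemma relations_in_F: "tensor_relations K M N \<subseteq> carrier F"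
  unfolding tensor_relations_def
  by (intro Un_least subsetI; elim CollectE exE conjE; hypsubst; intro diffF inF) auto

lemma subgroup_H: "subgroup H F"
  unfolding tensor_null_def by (rule F.generate_is_subgroup[OF relations_in_F])

lemma normal_H: "H \<lhd> F"
  by (rule F.subgroup_imp_normal[OF subgroup_H])

lemma H_in_F: "x \<in> H \<Longrightarrow> x \<in> carrier F"
  using subgroup.subset[OF subgroup_H] by blast

lemma H_zero: "0 \<in> H"
  using subgroup.one_closed[OF subgroup_H] by simp

lemma H_add: "x \<in> H \<Longrightarrow> y \<in> H \<Longrightarrow> x + y \<in> H"
  using subgroup.m_closed[OF subgroup_H] by simp

lemma H_uminus: "x \<in> H \<Longrightarrow> - x \<in> H"
  using subgroup.m_inv_closed[OF subgroup_H, of x] H_in_F[of x] by simp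

lemma H_diff: "x \<in> H \<Longrightarrow> y \<in> H \<Longrightarrow> x - y \<in> H"
  using H_add[of x "- y"] H_uminus[of y] by simp

lemma coset_mem: "y \<in> H #>\<^bsub>F\<^esub> x \<longleftrightarrow> y - x \<in> H"
proof -
  have "y \<in> H #>\<^bsub>F\<^esub> x \<longleftrightarrow> (\<exists>h\<in>H. y = h + x)"
    by (simp add: r_coset_def)
  also have "\<dots> \<longleftrightarrow> y - x \<in> H"
  proof
    assume "y - x \<in> H"
    then show "\<exists>h\<in>H. y = h + x" by (intro bexI[of _ "y - x"]) simp_all
  qed auto
  finally show ?thesis .
qed

lemma coset_eq: "H #>\<^bsub>F\<^esub> x = H #>\<^bsub>F\<^esub> y \<longleftrightarrow> x - y \<in> H"
proof
  assume "H #>\<^bsub>F\<^esub> x = H #>\<^bsub>F\<^esub> y"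
  moreover have "x \<in> H #>\<^bsub>F\<^esub> x" by (simp add: coset_mem H_zero)
  ultimately show "x - y \<in> H" by (simp add: coset_mem)
next
  assume xy: "x - y \<in> H"
  show "H #>\<^bsub>F\<^esub> x = H #>\<^bsub>F\<^esub> y"
  proof (rule Set.set_eqI)
    fix z
    have "z - y \<in> H" if "z - x \<in> H" using H_add[OF that xy] by simp
    moreover have "z - x \<in> H" if "z - y \<in> H" using H_diff[OF that xy] by simp
    ultimately show "z \<in> H #>\<^bsub>F\<^esub> x \<longleftrightarrow> z \<in> H #>\<^bsub>F\<^esub> y" by (auto simp: coset_mem)
  qed
qed

lemma carrier_T: "carrier T = (\<lambda>x. H #>\<^bsub>F\<^esub> x) ` carrier F"
  by (simp add: tensor_product_def Let_def carrier_FactGroup)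

lemma zero_T: "\<zero>\<^bsub>T\<^esub> = H #>\<^bsub>F\<^esub> 0"
proof -
  have "H #>\<^bsub>F\<^esub> 0 = H" by (rule Set.set_eqI) (simp add: coset_mem)
  then show ?thesis by (simp add: tensor_product_def Let_def)
qed

lemma add_T:
  assumes "x \<in> carrier F" "y \<in> carrier F"
  shows "(H #>\<^bsub>F\<^esub> x) \<oplus>\<^bsub>T\<^esub> (H #>\<^bsub>F\<^esub> y) = H #>\<^bsub>F\<^esub> (x + y)"
  using normal.rcos_sum[OF normal_H assms] by (simp add: tensor_product_def Let_def)

lemma scale_in_F:
  assumes "c \<in> carrier K" "x \<in> carrier F" shows "scale c x \<in> carrier F"
proof -
  have "Poly_Mapping.keys x \<subseteq> carrier M \<times> carrier N" using assms(2) by simp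
  then show ?thesis
  proof (induction x rule: frag_induction)
    case zero
    then show ?case by simp
  next
    case (one p)
    then show ?case using assms(1) by (auto simp: keys_frag_of)
  next
    case (diff a b)
    then show ?case by (simp only: frag_extend_diff diffF)
  qed
qed

lemma relation_add_left:
  "m \<in> carrier M \<Longrightarrow> m' \<in> carrier M \<Longrightarrow> n \<in> carrier N
    \<Longrightarrow> frag_of (m \<oplus>\<^bsub>M\<^esub> m', n) - frag_of (m, n) - frag_of (m', n) \<in> tensor_relations K M N"
  unfolding tensor_relations_def by blast

lemma relation_add_right:
  "m \<in> carrier M \<Longrightarrow> n \<in> carrier N \<Longrightarrow> n' \<in> carrier N
    \<Longrightarrow> frag_of (m, n \<oplus>\<^bsub>N\<^esub> n') - frag_of (m, n) - frag_of (m, n') \<in> tensor_relations K M N"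
  unfolding tensor_relations_def by blast

lemma relation_smult:
  "c \<in> carrier K \<Longrightarrow> m \<in> carrier M \<Longrightarrow> n \<in> carrier N
    \<Longrightarrow> frag_of (c \<odot>\<^bsub>M\<^esub> m, n) - frag_of (m, c \<odot>\<^bsub>N\<^esub> n) \<in> tensor_relations K M N"
  unfolding tensor_relations_def by blast

lemma relation_cases:
  assumes "r \<in> tensor_relations K M N"
  obtains
    (add_left) m m' n where "m \<in> carrier M" "m' \<in> carrier M" "n \<in> carrier N"
      "r = frag_of (m \<oplus>\<^bsub>M\<^esub> m', n) - frag_of (m, n) - frag_of (m', n)"
  | (add_right) m n n' where "m \<in> carrier M" "n \<in> carrier N" "n' \<in> carrier N"
      "r = frag_of (m, n \<oplus>\<^bsub>N\<^esub> n') - frag_of (m, n) - frag_of (m, n')"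
  | (smult) c m n where "c \<in> carrier K" "m \<in> carrier M" "n \<in> carrier N"
      "r = frag_of (c \<odot>\<^bsub>M\<^esub> m, n) - frag_of (m, c \<odot>\<^bsub>N\<^esub> n)"
  using assms unfolding tensor_relations_def
  by (elim UnE CollectE exE conjE) (rule add_left add_right smult; assumption)+

lemma relation_in_H: "r \<in> tensor_relations K M N \<Longrightarrow> r \<in> H"
  unfolding tensor_null_def by (rule generate.incl)

lemma scale_relation:
  assumes c: "c \<in> carrier K" and r: "r \<in> tensor_relations K M N"
  shows "scale c r \<in> tensor_relations K M N"
  using r
proof (cases rule: relation_cases)
  case (add_left m m' n)
  then show ?thesis
    using relation_add_left[of "c \<odot>\<^bsub>M\<^esub> m" "c \<odot>\<^bsub>M\<^esub> m'" n] c
    by (simp add: frag_extend_diff M.smult_r_distr)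
next
  case (add_right m n n')
  then show ?thesis
    using relation_add_right[of "c \<odot>\<^bsub>M\<^esub> m" n n'] c by (simp add: frag_extend_diff)
next
  case (smult d m n)
  have "c \<odot>\<^bsub>M\<^esub> (d \<odot>\<^bsub>M\<^esub> m) = (c \<otimes> d) \<odot>\<^bsub>M\<^esub> m"
    using c smult by (simp add: M.smult_assoc1)
  also have "\<dots> = (d \<otimes> c) \<odot>\<^bsub>M\<^esub> m" by (simp only: M.m_comm[OF c smult(1)])
  also have "\<dots> = d \<odot>\<^bsub>M\<^esub> (c \<odot>\<^bsub>M\<^esub> m)" using c smult by (simp add: M.smult_assoc1)
  finally show ?thesis
    using relation_smult[of d "c \<odot>\<^bsub>M\<^esub> m" n] c smult by (simp add: frag_extend_diff)
qed

lemma scale_H: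
  assumes c: "c \<in> carrier K" and "x \<in> H" shows "scale c x \<in> H"
  using assms(2) unfolding tensor_null_def
proof (induction rule: generate.induct)
  case one
  then show ?case using generate.one[of F] by simp
next
  case (incl h)
  then show ?case by (intro generate.incl scale_relation c)
next
  case (inv h)
  have "h \<in> carrier F" using relations_in_F inv by blast
  then have "scale c (inv\<^bsub>F\<^esub> h) = inv\<^bsub>F\<^esub> (scale c h)"
    using scale_in_F[OF c, of h] by (simp add: frag_extend_minus)
  then show ?case using generate.inv[OF scale_relation[OF c inv]] by simp
next
  case (eng h1 h2)
  then show ?case
    using generate.eng[OF eng.IH] by (simp add: frag_extend_add)
qed

lemma smult_T:
  assumes c: "c \<in> carrier K" and x: "x \<in> carrier F"
  shows "c \<odot>\<^bsub>T\<^esub> (H #>\<^bsub>F\<^esub> x) = H #>\<^bsub>F\<^esub> scale c x"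
proof -
  have "c \<odot>\<^bsub>T\<^esub> (H #>\<^bsub>F\<^esub> x) = {h + scale c y | h y. h \<in> H \<and> y - x \<in> H}"
    by (simp add: tensor_product_def Let_def set_mult_def)
       (simp add: set_eq_iff Bex_def coset_mem, blast)
  also have "\<dots> = H #>\<^bsub>F\<^esub> scale c x"
  proof (intro Set.set_eqI iffI)
    fix z assume "z \<in> {h + scale c y | h y. h \<in> H \<and> y - x \<in> H}"
    then obtain h y where z: "z = h + scale c y" and h: "h \<in> H" and y: "y - x \<in> H" by blast
    have "h + scale c (y - x) \<in> H" using H_add[OF h scale_H[OF c y]] .
    then show "z \<in> H #>\<^bsub>F\<^esub> scale c x"
      by (simp add: coset_mem z frag_extend_diff add_diff_eq)
  next
    fix z assume "z \<in> H #>\<^bsub>F\<^esub> scale c x"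
    then have "z - scale c x \<in> H" "z = (z - scale c x) + scale c x" "x - x \<in> H"
      by (auto simp: coset_mem H_zero)
    then show "z \<in> {h + scale c y | h y. h \<in> H \<and> y - x \<in> H}" by blast
  qed
  finally show ?thesis .
qed

lemma tensor_closed: "m \<in> carrier M \<Longrightarrow> n \<in> carrier N \<Longrightarrow> t m n \<in> carrier T"
  by (auto simp: tensor_def carrier_T keys_frag_of)

lemma module_tensor_product: "module K T"
proof (rule moduleI)
  show "cring K" by (rule M.is_cring)
  show "abelian_group T"
  proof -
    interpret Q: comm_group "F Mod H" by (rule F.abelian_FactGroup[OF subgroup_H])
    have "carrier T = carrier (F Mod H)" "\<zero>\<^bsub>T\<^esub> = \<one>\<^bsub>F Mod H\<^esub>"
      "x \<oplus>\<^bsub>T\<^esub> y = x \<otimes>\<^bsub>F Mod H\<^esub> y" for x y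
      by (simp_all add: tensor_product_def Let_def)
    then show ?thesis
      by (intro abelian_groupI) (simp_all add: Q.m_ac Q.l_inv_ex del: mult_FactGroup one_FactGroup)
  qed
next
  fix c X assume c: "c \<in> carrier K" and "X \<in> carrier T"
  then obtain x where "x \<in> carrier F" "X = H #>\<^bsub>F\<^esub> x" by (auto simp: carrier_T)
  then show "c \<odot>\<^bsub>T\<^esub> X \<in> carrier T"
    using scale_in_F[OF c] smult_T[OF c] by (auto simp: carrier_T)
next
  fix c X Y assume c: "c \<in> carrier K" and "X \<in> carrier T" "Y \<in> carrier T"
  then obtain x y where x: "x \<in> carrier F" "X = H #>\<^bsub>F\<^esub> x" and y: "y \<in> carrier F" "Y = H #>\<^bsub>F\<^esub> y"
    by (auto simp: carrier_T)
  have xy: "x + y \<in> carrier F" using F.m_closed[OF x(1) y(1)] by simp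
  show "c \<odot>\<^bsub>T\<^esub> (X \<oplus>\<^bsub>T\<^esub> Y) = c \<odot>\<^bsub>T\<^esub> X \<oplus>\<^bsub>T\<^esub> c \<odot>\<^bsub>T\<^esub> Y"
    by (simp only: x(2) y(2) add_T[OF x(1) y(1)] smult_T[OF c xy] smult_T[OF c x(1)]
        smult_T[OF c y(1)] add_T[OF scale_in_F[OF c x(1)] scale_in_F[OF c y(1)]] frag_extend_add)
next
  fix c d X assume c: "c \<in> carrier K" and d: "d \<in> carrier K" and "X \<in> carrier T"
  then obtain x where x: "x \<in> carrier F" "X = H #>\<^bsub>F\<^esub> x" by (auto simp: carrier_T)
  have cd: "c \<oplus> d \<in> carrier K" "c \<otimes> d \<in> carrier K" using c d by auto
  have keys: "Poly_Mapping.keys x \<subseteq> carrier M \<times> carrier N" using x by simp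
  have "scale (c \<oplus> d) x - (scale c x + scale d x) \<in> H"
    using keys
  proof (induction x rule: frag_induction)
    case zero
    then show ?case by (simp add: H_zero)
  next
    case (one p)
    obtain m n where p: "p = (m, n)" "m \<in> carrier M" "n \<in> carrier N" using one by auto
    have "frag_of (c \<odot>\<^bsub>M\<^esub> m \<oplus>\<^bsub>M\<^esub> d \<odot>\<^bsub>M\<^esub> m, n) - frag_of (c \<odot>\<^bsub>M\<^esub> m, n) - frag_of (d \<odot>\<^bsub>M\<^esub> m, n) \<in> H"
      using c d p by (intro relation_in_H relation_add_left) auto
    then show ?case using c d p by (simp add: M.smult_l_distr diff_diff_eq)
  next
    case (diff a b)
    then show ?case
      using H_diff[OF diff] by (simp add: frag_extend_diff algebra_simps)
  qed
  then show "(c \<oplus> d) \<odot>\<^bsub>T\<^esub> X = c \<odot>\<^bsub>T\<^esub> X \<oplus>\<^bsub>T\<^esub> d \<odot>\<^bsub>T\<^esub> X"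
    unfolding x(2) smult_T[OF c x(1)] smult_T[OF d x(1)] smult_T[OF cd(1) x(1)]
      add_T[OF scale_in_F[OF c x(1)] scale_in_F[OF d x(1)]] coset_eq .
  have "scale (c \<otimes> d) x = scale c (scale d x)"
    using keys
    by (induction x rule: frag_induction) (use c d in \<open>auto simp: frag_extend_diff M.smult_assoc1\<close>)
  then show "(c \<otimes> d) \<odot>\<^bsub>T\<^esub> X = c \<odot>\<^bsub>T\<^esub> (d \<odot>\<^bsub>T\<^esub> X)"
    unfolding x(2) smult_T[OF d x(1)] smult_T[OF cd(2) x(1)] smult_T[OF c scale_in_F[OF d x(1)]]
    by simp
next
  fix X assume "X \<in> carrier T"
  then obtain x where x: "x \<in> carrier F" "X = H #>\<^bsub>F\<^esub> x" by (auto simp: carrier_T)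
  then have keys: "Poly_Mapping.keys x \<subseteq> carrier M \<times> carrier N" by simp
  have "scale \<one> x = x"
    using keys by (induction x rule: frag_induction) (auto simp: frag_extend_diff)
  then show "\<one> \<odot>\<^bsub>T\<^esub> X = X"
    unfolding x(2) smult_T[OF M.one_closed x(1)] by simp
qed

lemma tensor_bilinear: "t \<in> bilinear_maps K M N T"
proof -
  have addl: "t (m \<oplus>\<^bsub>M\<^esub> m') n = t m n \<oplus>\<^bsub>T\<^esub> t m' n"
    if mn: "m \<in> carrier M" "m' \<in> carrier M" "n \<in> carrier N" for m m' n
  proof -
    from relation_in_H[OF relation_add_left[OF mn]] show ?thesis
      unfolding tensor_def add_T[OF inF[OF mn(1,3)] inF[OF mn(2,3)]] coset_eq
      by (simp add: diff_diff_eq)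
  qed
  have addr: "t m (n \<oplus>\<^bsub>N\<^esub> n') = t m n \<oplus>\<^bsub>T\<^esub> t m n'"
    if mn: "m \<in> carrier M" "n \<in> carrier N" "n' \<in> carrier N" for m n n'
  proof -
    from relation_in_H[OF relation_add_right[OF mn]] show ?thesis
      unfolding tensor_def add_T[OF inF[OF mn(1,2)] inF[OF mn(1,3)]] coset_eq
      by (simp add: diff_diff_eq)
  qed
  have sl: "t (c \<odot>\<^bsub>M\<^esub> m) n = c \<odot>\<^bsub>T\<^esub> t m n"
    if mn: "c \<in> carrier K" "m \<in> carrier M" "n \<in> carrier N" for c m n
    unfolding tensor_def smult_T[OF mn(1) inF[OF mn(2,3)]] by simp
  have sr: "t m (c \<odot>\<^bsub>N\<^esub> n) = c \<odot>\<^bsub>T\<^esub> t m n"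
    if mn: "c \<in> carrier K" "m \<in> carrier M" "n \<in> carrier N" for c m n
  proof -
    from relation_in_H[OF relation_smult[OF mn]] have "t (c \<odot>\<^bsub>M\<^esub> m) n = t m (c \<odot>\<^bsub>N\<^esub> n)"
      unfolding tensor_def coset_eq .
    with sl[OF mn] show ?thesis by simp
  qed
  show ?thesis
    by (auto simp: bilinear_maps_def linear_maps_def tensor_closed addl addr sl sr)
qed

lemma tensor_ext:
  assumes g: "g \<in> linear_maps K T P" and h: "h \<in> linear_maps K T P" and P: "module K P"
    and eq: "\<And>m n. m \<in> carrier M \<Longrightarrow> n \<in> carrier N \<Longrightarrow> g (t m n) = h (t m n)"
    and X: "X \<in> carrier T"
  shows "g X = h X"
proof -
  interpret P: module K P by (rule P)
  interpret T: module K T by (rule module_tensor_product)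
  obtain x where x: "x \<in> carrier F" "X = H #>\<^bsub>F\<^esub> x" using X by (auto simp: carrier_T)
  have keys: "Poly_Mapping.keys x \<subseteq> carrier M \<times> carrier N" using x by simp
  have add: "f (a \<oplus>\<^bsub>T\<^esub> b) = f a \<oplus>\<^bsub>P\<^esub> f b" and cl: "f a \<in> carrier P"
    if "f \<in> linear_maps K T P" "a \<in> carrier T" "b \<in> carrier T" for f a b
    using that by (auto simp: linear_maps_def)
  have *: "x \<in> carrier F \<and> g (H #>\<^bsub>F\<^esub> x) = h (H #>\<^bsub>F\<^esub> x)"
    using keys
  proof (induction x rule: frag_induction)
    case zero
    have "f \<zero>\<^bsub>T\<^esub> = \<zero>\<^bsub>P\<^esub>" if f: "f \<in> linear_maps K T P" for f
    proof -
      have "f \<zero>\<^bsub>T\<^esub> \<oplus>\<^bsub>P\<^esub> f \<zero>\<^bsub>T\<^esub> = f \<zero>\<^bsub>T\<^esub>"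
        using add[OF f T.zero_closed T.zero_closed] by simp
      then show ?thesis using cl[OF f T.zero_closed T.zero_closed] by (metis P.add.l_cancel_one')
    qed
    from this[OF g] this[OF h] show ?case by (simp add: zero_T[symmetric])
  next
    case (one p)
    then show ?case using eq by (auto simp: tensor_def keys_frag_of)
  next
    case (diff a b)
    then have a: "a \<in> carrier F" and b: "b \<in> carrier F" by auto
    have ab: "a - b \<in> carrier F"
      by (rule diffF[OF a b])
    have "H #>\<^bsub>F\<^esub> a = (H #>\<^bsub>F\<^esub> (a - b)) \<oplus>\<^bsub>T\<^esub> (H #>\<^bsub>F\<^esub> b)"
      using add_T[OF ab b] by simp
    moreover have c: "H #>\<^bsub>F\<^esub> (a - b) \<in> carrier T" "H #>\<^bsub>F\<^esub> b \<in> carrier T"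
      using ab b by (auto simp only: carrier_T)
    ultimately have "g (H #>\<^bsub>F\<^esub> (a - b)) \<oplus>\<^bsub>P\<^esub> g (H #>\<^bsub>F\<^esub> b) = h (H #>\<^bsub>F\<^esub> (a - b)) \<oplus>\<^bsub>P\<^esub> h (H #>\<^bsub>F\<^esub> b)"
      using diff add[OF g c] add[OF h c] by metis
    then have "g (H #>\<^bsub>F\<^esub> (a - b)) = h (H #>\<^bsub>F\<^esub> (a - b))"
      using diff cl[OF g c] cl[OF h c] cl[OF g c(2,2)] cl[OF h c(2,2)] by (metis P.add.right_cancel)
    with ab show ?case by blast
  qed
  then show ?thesis by (simp add: x)
qed

lemma lift_exists:
  assumes P: "module K P" and f: "f \<in> bilinear_maps K M N P"
  obtains h where "h \<in> linear_maps K T P"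
    "\<And>m n. m \<in> carrier M \<Longrightarrow> n \<in> carrier N \<Longrightarrow> h (t m n) = f m n"
proof -
  interpret P: module K P by (rule P)
  have fc: "f m n \<in> carrier P" if "m \<in> carrier M" "n \<in> carrier N" for m n
    using f that by (auto simp: bilinear_maps_def linear_maps_def)
  have im: "(\<lambda>(m, n). f m n) ` (carrier M \<times> carrier N) \<subseteq> carrier (add_monoid P)"
    by (auto simp: fc)
  obtain u where u: "u \<in> hom F (add_monoid P)"
    and ut: "\<And>p. p \<in> carrier M \<times> carrier N \<Longrightarrow> u (frag_of p) = (\<lambda>(m, n). f m n) p"
    by (rule comm_group.free_Abelian_group_universal[OF P.a_comm_group im]) (rule that)
  interpret u: group_hom F "add_monoid P" u
    by (simp add: group_hom_def group_hom_axioms_def u P.a_group)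
  have uc: "u x \<in> carrier P" if "x \<in> carrier F" for x
    using u.hom_closed[OF that] by simp
  have uadd: "u (a + b) = u a \<oplus>\<^bsub>P\<^esub> u b" if "a \<in> carrier F" "b \<in> carrier F" for a b
    using u.hom_mult[OF that] by simp
  have udiff: "u (a - b) = u a \<ominus>\<^bsub>P\<^esub> u b" if a: "a \<in> carrier F" and b: "b \<in> carrier F" for a b
  proof -
    have "u a = u (a - b) \<oplus>\<^bsub>P\<^esub> u b" using uadd[OF diffF[OF a b] b] by simp
    then show ?thesis using uc[OF a] uc[OF b] uc[OF diffF[OF a b]]
      by (simp add: a_minus_def P.a_assoc P.r_neg)
  qed
  have addf: "f (m \<oplus>\<^bsub>M\<^esub> m') n = f m n \<oplus>\<^bsub>P\<^esub> f m' n"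
    if "m \<in> carrier M" "m' \<in> carrier M" "n \<in> carrier N" for m m' n
    using f that by (auto simp: bilinear_maps_def linear_maps_def)
  have addf': "f m (n \<oplus>\<^bsub>N\<^esub> n') = f m n \<oplus>\<^bsub>P\<^esub> f m n'"
    if "m \<in> carrier M" "n' \<in> carrier N" "n \<in> carrier N" for m n n'
    using f that by (auto simp: bilinear_maps_def linear_maps_def)
  have smf: "f (c \<odot>\<^bsub>M\<^esub> m) n = c \<odot>\<^bsub>P\<^esub> f m n" "f m (c \<odot>\<^bsub>N\<^esub> n) = c \<odot>\<^bsub>P\<^esub> f m n"
    if "c \<in> carrier K" "m \<in> carrier M" "n \<in> carrier N" for c m n
    using f that by (auto simp: bilinear_maps_def linear_maps_def)
  have self: "a \<ominus>\<^bsub>P\<^esub> a = \<zero>\<^bsub>P\<^esub>" if "a \<in> carrier P" for a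
    using that by (simp add: a_minus_def P.r_neg)
  have cancel: "(a \<oplus>\<^bsub>P\<^esub> b) \<ominus>\<^bsub>P\<^esub> a \<ominus>\<^bsub>P\<^esub> b = \<zero>\<^bsub>P\<^esub>" if ab: "a \<in> carrier P" "b \<in> carrier P" for a b
  proof -
    have "(a \<oplus>\<^bsub>P\<^esub> b) \<ominus>\<^bsub>P\<^esub> a = b"
      unfolding P.a_comm[OF ab] using ab by (simp add: a_minus_def P.a_assoc P.r_neg)
    then show ?thesis using self[OF ab(2)] by simp
  qed
  have relk: "tensor_relations K M N \<subseteq> kernel F (add_monoid P) u"
  proof
    fix r assume r: "r \<in> tensor_relations K M N"
    then have rF: "r \<in> carrier F" using relations_in_F by blast
    from r have "u r = \<zero>\<^bsub>P\<^esub>"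
      by (cases rule: relation_cases)
         (simp_all add: udiff diffF inF ut addf addf' smf fc cancel self
            del: carrier_free_Abelian_group_iff)
    with rF show "r \<in> kernel F (add_monoid P) u" by (simp add: kernel_def)
  qed
  have Hk: "H \<subseteq> kernel F (add_monoid P) u"
    unfolding tensor_null_def by (rule F.generate_subgroup_incl[OF relk u.subgroup_kernel])
  obtain h where h: "h \<in> hom (F Mod H) (add_monoid P)"
    and hu: "\<And>x. x \<in> carrier F \<Longrightarrow> h (H #>\<^bsub>F\<^esub> x) = u x"
    by (rule u.FactGroup_universal_kernel[OF normal_H Hk]) (rule that)
  have usc: "u (scale c x) = c \<odot>\<^bsub>P\<^esub> u x" if c: "c \<in> carrier K" and x: "x \<in> carrier F" for c x
  proof -
    interpret s: group_hom F "add_monoid P" "\<lambda>x. c \<odot>\<^bsub>P\<^esub> u x"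
      using c uc uadd
      by (auto simp: group_hom_def group_hom_axioms_def P.a_group F.is_group P.smult_r_distr hom_def
            simp del: carrier_free_Abelian_group_iff)
    have keys: "Poly_Mapping.keys x \<subseteq> carrier M \<times> carrier N" using x by simp
    have "x \<in> carrier F \<and> u (scale c x) = c \<odot>\<^bsub>P\<^esub> u x"
      using keys
    proof (induction x rule: frag_induction)
      case zero
      then show ?case using u.hom_one s.hom_one by simp
    next
      case (one p)
      then show ?case using c by (auto simp: ut smf inF keys_frag_of)
    next
      case (diff a b)
      have e: "c \<odot>\<^bsub>P\<^esub> u a = c \<odot>\<^bsub>P\<^esub> u (a - b) \<oplus>\<^bsub>P\<^esub> c \<odot>\<^bsub>P\<^esub> u b"
        using s.hom_mult[of "a - b" b] diffF[of a b] diff by simp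
      have cl: "c \<odot>\<^bsub>P\<^esub> u (a - b) \<in> carrier P" "c \<odot>\<^bsub>P\<^esub> u b \<in> carrier P"
        using c uc diffF diff by auto
      have "u (scale c (a - b)) = c \<odot>\<^bsub>P\<^esub> u a \<ominus>\<^bsub>P\<^esub> c \<odot>\<^bsub>P\<^esub> u b"
        using diff udiff[OF scale_in_F[OF c] scale_in_F[OF c]] by (simp add: frag_extend_diff)
      also have "\<dots> = c \<odot>\<^bsub>P\<^esub> u (a - b)"
        using cl by (simp add: e a_minus_def P.a_assoc P.r_neg)
      finally show ?case using diff diffF by blast
    qed
    then show ?thesis by blast
  qed
  show thesis
  proof
    have hc: "h X \<in> carrier P" if "X \<in> carrier T" for X
      using that uc hu by (auto simp only: carrier_T)
    moreover have "h (X \<oplus>\<^bsub>T\<^esub> Y) = h X \<oplus>\<^bsub>P\<^esub> h Y" if "X \<in> carrier T" "Y \<in> carrier T" for X Y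
      using hom_mult[OF h, of X Y] that by (simp add: tensor_product_def Let_def)
    moreover have "h (c \<odot>\<^bsub>T\<^esub> X) = c \<odot>\<^bsub>P\<^esub> h X" if c: "c \<in> carrier K" and X: "X \<in> carrier T" for c X
    proof -
      obtain x where x: "x \<in> carrier F" "X = H #>\<^bsub>F\<^esub> x" using X by (auto simp: carrier_T)
      show ?thesis
        unfolding x(2) smult_T[OF c x(1)] hu[OF x(1)] hu[OF scale_in_F[OF c x(1)]]
        by (rule usc[OF c x(1)])
    qed
    ultimately show "h \<in> linear_maps K T P" by (auto simp: linear_maps_def)
    show "h (t m n) = f m n" if "m \<in> carrier M" "n \<in> carrier N" for m n
      using hu[OF inF[OF that]] ut[of "(m, n)"] that by (simp add: tensor_def)
  qed
qed

lemma tensor_lift_unique_existence: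
  assumes P: "module K P" and f: "f \<in> bilinear_maps K M N P"
  shows "\<exists>!h. h \<in> linear_maps K T P \<and> h \<in> extensional (carrier T) \<and>
             (\<forall>m\<in>carrier M. \<forall>n\<in>carrier N. h (t m n) = f m n)"
proof -
  interpret T: module K T by (rule module_tensor_product)
  obtain h where h: "h \<in> linear_maps K T P"
    "\<And>m n. m \<in> carrier M \<Longrightarrow> n \<in> carrier N \<Longrightarrow> h (t m n) = f m n"
    by (rule lift_exists[OF P f]) (rule that)
  show ?thesis
  proof (rule ex1I)
    show "restrict h (carrier T) \<in> linear_maps K T P \<and> restrict h (carrier T) \<in> extensional (carrier T) \<and>
        (\<forall>m\<in>carrier M. \<forall>n\<in>carrier N. restrict h (carrier T) (t m n) = f m n)"
      using h by (auto simp: linear_maps_def tensor_closed)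
    fix g assume g: "g \<in> linear_maps K T P \<and> g \<in> extensional (carrier T) \<and>
             (\<forall>m\<in>carrier M. \<forall>n\<in>carrier N. g (t m n) = f m n)"
    show "g = restrict h (carrier T)"
    proof (rule extensionalityI[where A = "carrier T"])
      fix X assume X: "X \<in> carrier T"
      then show "g X = restrict h (carrier T) X"
        using tensor_ext[of g P h X] g h P by simp
    qed (use g in auto)
  qed
qed

lemma tensor_lift:
  assumes P: "module K P" and f: "f \<in> bilinear_maps K M N P"
  shows "tensor_lift K M N P f \<in> linear_maps K T P"
    and "m \<in> carrier M \<Longrightarrow> n \<in> carrier N \<Longrightarrow> tensor_lift K M N P f (t m n) = f m n"
  using theI'[OF tensor_lift_unique_existence[OF P f]] by (auto simp: tensor_lift_def)

end

section \<open>Maps between tensor products\<close>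

definition tensor_map ::
  "('k, 'r) ring_scheme \<Rightarrow> ('k, 'a, 'p) module_scheme \<Rightarrow> ('k, 'b, 'q) module_scheme
    \<Rightarrow> ('k, 'c, 's) module_scheme \<Rightarrow> ('k, 'd, 't) module_scheme
    \<Rightarrow> ('a \<Rightarrow> 'c) \<Rightarrow> ('b \<Rightarrow> 'd) \<Rightarrow> ('a \<times> 'b \<Rightarrow>\<^sub>0 int) set \<Rightarrow> ('c \<times> 'd \<Rightarrow>\<^sub>0 int) set"
  where
  "tensor_map K M N M' N' f g =
     tensor_lift K M N (tensor_product K M' N') (\<lambda>m n. tensor K M' N' (f m) (g n))"

text \<open>
  The canonical isomorphisms \<open>(M \<otimes> N) \<otimes> P \<cong> M \<otimes> (N \<otimes> P)\<close>, in both directions: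
  \<open>(m \<otimes> n) \<otimes> p \<leftrightarrow> m \<otimes> (n \<otimes> p)\<close>.
\<close>

definition tensor_assoc ::
  "('k, 'r) ring_scheme \<Rightarrow> ('k, 'a, 'p) module_scheme \<Rightarrow> ('k, 'b, 'q) module_scheme
    \<Rightarrow> ('k, 'c, 's) module_scheme
    \<Rightarrow> (('a \<times> 'b \<Rightarrow>\<^sub>0 int) set \<times> 'c \<Rightarrow>\<^sub>0 int) set \<Rightarrow> ('a \<times> ('b \<times> 'c \<Rightarrow>\<^sub>0 int) set \<Rightarrow>\<^sub>0 int) set"
  where
  "tensor_assoc K M N P =
     (let NP = tensor_product K N P; Q = tensor_product K M NP
      in tensor_lift K (tensor_product K M N) P Q
           (\<lambda>x p. tensor_lift K M N Q (\<lambda>m n. tensor K M NP m (tensor K N P n p)) x))"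

definition tensor_assoc_inv ::
  "('k, 'r) ring_scheme \<Rightarrow> ('k, 'a, 'p) module_scheme \<Rightarrow> ('k, 'b, 'q) module_scheme
    \<Rightarrow> ('k, 'c, 's) module_scheme
    \<Rightarrow> ('a \<times> ('b \<times> 'c \<Rightarrow>\<^sub>0 int) set \<Rightarrow>\<^sub>0 int) set \<Rightarrow> (('a \<times> 'b \<Rightarrow>\<^sub>0 int) set \<times> 'c \<Rightarrow>\<^sub>0 int) set"
  where
  "tensor_assoc_inv K M N P =
     (let MN = tensor_product K M N; Q = tensor_product K MN P
      in tensor_lift K M (tensor_product K N P) Q
           (\<lambda>m y. tensor_lift K N P Q (\<lambda>n p. tensor K MN P (tensor K M N m n) p) y))"

section \<open>Rota-Baxter systems and weak pseudotwistors\<close>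

text \<open>
  Algebras are associative and not necessarily unital: the field \<open>one\<close> of the record \<open>A\<close>
  is not constrained.  (The locale \<open>algebra\<close> of HOL-Algebra requires a commutative unital ring.)
\<close>

locale assoc_algebra = field K + module K A for K (structure) and A +
  assumes mult_closed: "x \<in> carrier A \<Longrightarrow> y \<in> carrier A \<Longrightarrow> x \<otimes>\<^bsub>A\<^esub> y \<in> carrier A"
    and mult_assoc: "x \<in> carrier A \<Longrightarrow> y \<in> carrier A \<Longrightarrow> z \<in> carrier A
      \<Longrightarrow> (x \<otimes>\<^bsub>A\<^esub> y) \<otimes>\<^bsub>A\<^esub> z = x \<otimes>\<^bsub>A\<^esub> (y \<otimes>\<^bsub>A\<^esub> z)"
    and mult_bilinear: "(\<lambda>x y. x \<otimes>\<^bsub>A\<^esub> y) \<in> bilinear_maps K A A A"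

locale rota_baxter_system = assoc_algebra K A for K (structure) and A +
  fixes R S :: "'b \<Rightarrow> 'b"
  assumes R_linear: "R \<in> linear_maps K A A"
    and S_linear: "S \<in> linear_maps K A A"
    and R_mult: "a \<in> carrier A \<Longrightarrow> b \<in> carrier A
      \<Longrightarrow> R a \<otimes>\<^bsub>A\<^esub> R b = R (R a \<otimes>\<^bsub>A\<^esub> b \<oplus>\<^bsub>A\<^esub> a \<otimes>\<^bsub>A\<^esub> S b)"
    and S_mult: "a \<in> carrier A \<Longrightarrow> b \<in> carrier A
      \<Longrightarrow> S a \<otimes>\<^bsub>A\<^esub> S b = S (R a \<otimes>\<^bsub>A\<^esub> b \<oplus>\<^bsub>A\<^esub> a \<otimes>\<^bsub>A\<^esub> S b)"

text \<open>
  \<open>A \<otimes> A \<otimes> A\<close> is read as \<open>A \<otimes> (A \<otimes> A)\<close>.  The maps \<open>\<mu> \<otimes> id\<close> and \<open>T \<otimes> id\<close> live on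
  \<open>(A \<otimes> A) \<otimes> A\<close>, so the canonical isomorphisms are inserted in the second equation.
\<close>

definition weak_companion ::
  "('k, 'r) ring_scheme \<Rightarrow> ('k, 'a, 'p) module_scheme
    \<Rightarrow> (('a \<times> 'a \<Rightarrow>\<^sub>0 int) set \<Rightarrow> ('a \<times> 'a \<Rightarrow>\<^sub>0 int) set)
    \<Rightarrow> (('a \<times> ('a \<times> 'a \<Rightarrow>\<^sub>0 int) set \<Rightarrow>\<^sub>0 int) set \<Rightarrow> ('a \<times> ('a \<times> 'a \<Rightarrow>\<^sub>0 int) set \<Rightarrow>\<^sub>0 int) set)
    \<Rightarrow> bool"
  where
  "weak_companion K A T C \<longleftrightarrow>
     (let AA = tensor_product K A A;
          A_AA = tensor_product K A AA;
          AA_A = tensor_product K AA A;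
          \<mu> = tensor_lift K A A A (\<lambda>a b. a \<otimes>\<^bsub>A\<^esub> b);
          id_mu = tensor_map K A AA A A (\<lambda>a. a) \<mu>;
          id_T = tensor_map K A AA A AA (\<lambda>a. a) T;
          mu_id = tensor_map K AA A A A \<mu> (\<lambda>a. a);
          T_id = tensor_map K AA A AA A T (\<lambda>a. a);
          \<alpha> = tensor_assoc K A A A;
          \<beta> = tensor_assoc_inv K A A A
      in C \<in> linear_maps K A_AA A_AA \<and>
         (\<forall>x\<in>carrier A_AA. T (id_mu (id_T x)) = id_mu (C x)) \<and>
         (\<forall>x\<in>carrier AA_A. T (mu_id (T_id x)) = mu_id (\<beta> (C (\<alpha> x)))))"

definition weak_pseudotwistor ::
  "('k, 'r) ring_scheme \<Rightarrow> ('k, 'a, 'p) module_scheme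
    \<Rightarrow> (('a \<times> 'a \<Rightarrow>\<^sub>0 int) set \<Rightarrow> ('a \<times> 'a \<Rightarrow>\<^sub>0 int) set) \<Rightarrow> bool"
  where
  "weak_pseudotwistor K A T \<longleftrightarrow>
     T \<in> linear_maps K (tensor_product K A A) (tensor_product K A A) \<and>
     (\<exists>C. weak_companion K A T C)"

end

theory Submission
  imports Defs
begin

text \<open>
  The weak companion is
  \<open>a \<otimes> b \<otimes> c \<mapsto> R a \<otimes> R b \<otimes> c + R a \<otimes> b \<otimes> S c + a \<otimes> S b \<otimes> S c\<close>.
  With it, the first companion equation reduces on elementary tensors to
  \<open>S (R b c + b S c) = S b S c\<close> and the second one to \<open>R (R a b + a S b) = R a R b\<close>.
\<close>

section \<open>Closure properties of linear and bilinear maps\<close>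

lemma linear_maps_closed: "f \<in> linear_maps K M N \<Longrightarrow> x \<in> carrier M \<Longrightarrow> f x \<in> carrier N"
  by (auto simp: linear_maps_def)

lemma linear_maps_add:
  "f \<in> linear_maps K M N \<Longrightarrow> x \<in> carrier M \<Longrightarrow> y \<in> carrier M \<Longrightarrow> f (x \<oplus>\<^bsub>M\<^esub> y) = f x \<oplus>\<^bsub>N\<^esub> f y"
  by (auto simp: linear_maps_def)

lemma linear_maps_smult:
  "f \<in> linear_maps K M N \<Longrightarrow> c \<in> carrier K \<Longrightarrow> x \<in> carrier M \<Longrightarrow> f (c \<odot>\<^bsub>M\<^esub> x) = c \<odot>\<^bsub>N\<^esub> f x"
  by (auto simp: linear_maps_def)

lemma linear_maps_id: "(\<lambda>x. x) \<in> linear_maps K M M"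
  by (auto simp: linear_maps_def)

lemma linear_maps_comp:
  "f \<in> linear_maps K M N \<Longrightarrow> g \<in> linear_maps K N P \<Longrightarrow> (\<lambda>x. g (f x)) \<in> linear_maps K M P"
  by (auto simp: linear_maps_def Pi_iff)

lemma linear_maps_sum:
  assumes "module K N" "f \<in> linear_maps K M N" "g \<in> linear_maps K M N"
  shows "(\<lambda>x. f x \<oplus>\<^bsub>N\<^esub> g x) \<in> linear_maps K M N"
proof -
  interpret N: module K N by fact
  show ?thesis
    using assms(2,3) by (auto simp: linear_maps_def Pi_iff N.smult_r_distr N.a_ac)
qed

lemma linear_maps_scale:
  assumes "module K N" "f \<in> linear_maps K M N" "c \<in> carrier K"
  shows "(\<lambda>x. c \<odot>\<^bsub>N\<^esub> f x) \<in> linear_maps K M N"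
proof -
  interpret N: module K N by fact
  \<comment> \<open>Scaling by \<open>c\<close> is itself a linear map only because it commutes with
    scaling by \<open>d\<close>; this is where commutativity of \<open>K\<close> enters.\<close>
  have "c \<odot>\<^bsub>N\<^esub> (d \<odot>\<^bsub>N\<^esub> y) = d \<odot>\<^bsub>N\<^esub> (c \<odot>\<^bsub>N\<^esub> y)" if "d \<in> carrier K" "y \<in> carrier N" for d y
    using N.smult_assoc1[of c d y] N.smult_assoc1[of d c y] N.m_comm[of c d] assms(3) that by simp
  then show ?thesis
    using assms(2,3) by (auto simp: linear_maps_def Pi_iff N.smult_r_distr)
qed

lemma bilinear_maps_right: "f \<in> bilinear_maps K M N P \<Longrightarrow> m \<in> carrier M \<Longrightarrow> f m \<in> linear_maps K N P"
  by (simp add: bilinear_maps_def)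

lemma bilinear_maps_left:
  "f \<in> bilinear_maps K M N P \<Longrightarrow> n \<in> carrier N \<Longrightarrow> (\<lambda>m. f m n) \<in> linear_maps K M P"
  by (simp add: bilinear_maps_def)

lemma bilinear_maps_swap:
  "f \<in> bilinear_maps K M N P \<Longrightarrow> (\<lambda>n m. f m n) \<in> bilinear_maps K N M P"
  by (simp add: bilinear_maps_def)

text \<open>Precomposing the tensor \<otimes> with linear maps in each slot yields the bilinear maps
  behind \<open>tensor_map\<close>, the integrands of both associators, and the two summands of the
  twistor.\<close>

lemma bilinear_maps_comp:
  assumes "b \<in> bilinear_maps K M N P" "f \<in> linear_maps K M' M" "g \<in> linear_maps K N' N"
  shows "(\<lambda>m n. b (f m) (g n)) \<in> bilinear_maps K M' N' P"
  unfolding bilinear_maps_def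
  using linear_maps_comp[OF assms(3) bilinear_maps_right[OF assms(1) linear_maps_closed[OF assms(2)]]]
    linear_maps_comp[OF assms(2) bilinear_maps_left[OF assms(1) linear_maps_closed[OF assms(3)]]]
  by simp

lemma bilinear_maps_sum:
  "module K P \<Longrightarrow> f \<in> bilinear_maps K M N P \<Longrightarrow> g \<in> bilinear_maps K M N P
    \<Longrightarrow> (\<lambda>m n. f m n \<oplus>\<^bsub>P\<^esub> g m n) \<in> bilinear_maps K M N P"
  by (simp add: bilinear_maps_def linear_maps_sum)

section \<open>Maps induced on tensor products\<close>

context two_modules
begin

lemma tensor_map_linear:
  assumes "two_modules K M' N'" "f \<in> linear_maps K M M'" "g \<in> linear_maps K N N'"
  shows "tensor_map K M N M' N' f g \<in> linear_maps K T (tensor_product K M' N')"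
    and "m \<in> carrier M \<Longrightarrow> n \<in> carrier N
      \<Longrightarrow> tensor_map K M N M' N' f g (t m n) = tensor K M' N' (f m) (g n)"
proof -
  interpret two': two_modules K M' N' by fact
  note b = bilinear_maps_comp[OF two'.tensor_bilinear assms(2,3)]
  show "tensor_map K M N M' N' f g \<in> linear_maps K T (tensor_product K M' N')"
    unfolding tensor_map_def by (rule tensor_lift(1)[OF two'.module_tensor_product b])
  show "tensor_map K M N M' N' f g (t m n) = tensor K M' N' (f m) (g n)"
    if "m \<in> carrier M" "n \<in> carrier N"
    unfolding tensor_map_def by (rule tensor_lift(2)[OF two'.module_tensor_product b that])
qed

text \<open>This justifies nested lifts such as the one in \<open>tensor_assoc\<close>: the inner
  lift must be bilinear before the outer lift is meaningful. Linearity in \<open>x\<close> comes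
  from the lift itself. For linearity in \<open>p\<close>, both sides are linear in \<open>x\<close>
  and agree on elementary tensors because \<open>g m n\<close> is linear, so
  \<open>tensor_ext\<close> applies.\<close>

lemma tensor_lift_bilinear:
  assumes Q: "module K Q"
    and b: "\<And>p. p \<in> carrier P \<Longrightarrow> (\<lambda>m n. g m n p) \<in> bilinear_maps K M N Q"
    and l: "\<And>m n. m \<in> carrier M \<Longrightarrow> n \<in> carrier N \<Longrightarrow> g m n \<in> linear_maps K P Q"
    and P: "module K P"
  shows "(\<lambda>x p. tensor_lift K M N Q (\<lambda>m n. g m n p) x) \<in> bilinear_maps K T P Q"
proof -
  interpret P: module K P by fact
  let ?L = "\<lambda>p. tensor_lift K M N Q (\<lambda>m n. g m n p)"
  note L = tensor_lift[OF Q b]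
  have "?L (p \<oplus>\<^bsub>P\<^esub> q) x = ?L p x \<oplus>\<^bsub>Q\<^esub> ?L q x"
    if pq: "p \<in> carrier P" "q \<in> carrier P" and x: "x \<in> carrier T" for p q x
    by (rule tensor_ext[OF L(1)[OF P.a_closed[OF pq]] linear_maps_sum[OF Q L(1)[OF pq(1)] L(1)[OF pq(2)]] Q _ x])
       (simp add: L pq linear_maps_add[OF l])
  moreover have "?L (c \<odot>\<^bsub>P\<^esub> p) x = c \<odot>\<^bsub>Q\<^esub> ?L p x"
    if c: "c \<in> carrier K" and p: "p \<in> carrier P" and x: "x \<in> carrier T" for c p x
    by (rule tensor_ext[OF L(1)[OF P.smult_closed[OF c p]] linear_maps_scale[OF Q L(1)[OF p] c] Q _ x])
       (simp add: L p c linear_maps_smult[OF l])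
  moreover have "?L p x \<in> carrier Q" if "p \<in> carrier P" "x \<in> carrier T" for p x
    using linear_maps_closed[OF L(1)] that .
  ultimately have "(\<lambda>p. ?L p x) \<in> linear_maps K P Q" if "x \<in> carrier T" for x
    using that by (auto simp: linear_maps_def)
  with L(1) show ?thesis by (simp add: bilinear_maps_def)
qed

end

section \<open>Triple tensor products and their associativity isomorphisms\<close>

locale three_modules = two_modules K M N + P: module K P for K (structure) and M N P
begin

sublocale NP: two_modules K N P by unfold_locales
sublocale MN: module K T by (rule module_tensor_product)
sublocale NP: module K "tensor_product K N P" by (rule NP.module_tensor_product)
sublocale MN_P: two_modules K T P by unfold_locales
sublocale M_NP: two_modules K M "tensor_product K N P" by unfold_locales

text \<open>Two rounds of \<open>tensor_ext\<close>: the outer one reduces to \<open>m\<close>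
  \<otimes> \<open>y\<close>, and for fixed \<open>m\<close> the maps sending \<open>y\<close> to
  \<open>g\<close> and \<open>h\<close> of \<open>m\<close> \<otimes> \<open>y\<close> are linear,
  so the inner one reduces \<open>y\<close> to \<open>n\<close> \<otimes> \<open>p\<close>.\<close>

lemma tensor_ext_right:
  assumes g: "g \<in> linear_maps K M_NP.T Q" and h: "h \<in> linear_maps K M_NP.T Q" and Q: "module K Q"
    and eq: "\<And>m n p. m \<in> carrier M \<Longrightarrow> n \<in> carrier N \<Longrightarrow> p \<in> carrier P
      \<Longrightarrow> g (M_NP.t m (NP.t n p)) = h (M_NP.t m (NP.t n p))"
    and x: "x \<in> carrier M_NP.T"
  shows "g x = h x"
proof (rule M_NP.tensor_ext[OF g h Q _ x])
  fix m y assume m: "m \<in> carrier M" and y: "y \<in> carrier NP.T"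
  note l = linear_maps_comp[OF bilinear_maps_right[OF M_NP.tensor_bilinear m]]
  show "g (M_NP.t m y) = h (M_NP.t m y)"
    by (rule NP.tensor_ext[OF l[OF g] l[OF h] Q _ y]) (rule eq[OF m])
qed

lemma tensor_ext_left:
  assumes g: "g \<in> linear_maps K MN_P.T Q" and h: "h \<in> linear_maps K MN_P.T Q" and Q: "module K Q"
    and eq: "\<And>m n p. m \<in> carrier M \<Longrightarrow> n \<in> carrier N \<Longrightarrow> p \<in> carrier P
      \<Longrightarrow> g (MN_P.t (t m n) p) = h (MN_P.t (t m n) p)"
    and x: "x \<in> carrier MN_P.T"
  shows "g x = h x"
proof (rule MN_P.tensor_ext[OF g h Q _ x])
  fix y p assume y: "y \<in> carrier T" and p: "p \<in> carrier P"
  note l = linear_maps_comp[OF bilinear_maps_left[OF MN_P.tensor_bilinear p]]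
  show "g (MN_P.t y p) = h (MN_P.t y p)"
    by (rule tensor_ext[OF l[OF g] l[OF h] Q _ y]) (rule eq[OF _ _ p])
qed

lemma tensor_assoc_linear: "tensor_assoc K M N P \<in> linear_maps K MN_P.T M_NP.T"
  and tensor_assoc_tensor: "m \<in> carrier M \<Longrightarrow> n \<in> carrier N \<Longrightarrow> p \<in> carrier P
    \<Longrightarrow> tensor_assoc K M N P (MN_P.t (t m n) p) = M_NP.t m (NP.t n p)"
proof -
  have b: "(\<lambda>m n. M_NP.t m (NP.t n p)) \<in> bilinear_maps K M N M_NP.T" if "p \<in> carrier P" for p
    by (rule bilinear_maps_comp[OF M_NP.tensor_bilinear linear_maps_id
          bilinear_maps_left[OF NP.tensor_bilinear that]])
  have l: "(\<lambda>p. M_NP.t m (NP.t n p)) \<in> linear_maps K P M_NP.T"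
    if "m \<in> carrier M" "n \<in> carrier N" for m n
    by (rule linear_maps_comp[OF bilinear_maps_right[OF NP.tensor_bilinear that(2)]
          bilinear_maps_right[OF M_NP.tensor_bilinear that(1)]])
  note Q = M_NP.module_tensor_product
  have "(\<lambda>x p. tensor_lift K M N M_NP.T (\<lambda>m n. M_NP.t m (NP.t n p)) x) \<in> bilinear_maps K T P M_NP.T"
    by (rule tensor_lift_bilinear[OF Q b l P.module_axioms])
  note lift = MN_P.tensor_lift[OF Q this]
  show "tensor_assoc K M N P \<in> linear_maps K MN_P.T M_NP.T"
    unfolding tensor_assoc_def Let_def by (rule lift(1))
  show "tensor_assoc K M N P (MN_P.t (t m n) p) = M_NP.t m (NP.t n p)"
    if "m \<in> carrier M" "n \<in> carrier N" "p \<in> carrier P"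
    unfolding tensor_assoc_def Let_def
    by (simp only: lift(2)[OF tensor_closed[OF that(1,2)] that(3)]
        tensor_lift(2)[OF Q b[OF that(3)] that(1,2)])
qed

lemma tensor_assoc_inv_linear: "tensor_assoc_inv K M N P \<in> linear_maps K M_NP.T MN_P.T"
  and tensor_assoc_inv_tensor: "m \<in> carrier M \<Longrightarrow> n \<in> carrier N \<Longrightarrow> p \<in> carrier P
    \<Longrightarrow> tensor_assoc_inv K M N P (M_NP.t m (NP.t n p)) = MN_P.t (t m n) p"
proof -
  have b: "(\<lambda>n p. MN_P.t (t m n) p) \<in> bilinear_maps K N P MN_P.T" if "m \<in> carrier M" for m
    by (rule bilinear_maps_comp[OF MN_P.tensor_bilinear
          bilinear_maps_right[OF tensor_bilinear that] linear_maps_id])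
  have l: "(\<lambda>m. MN_P.t (t m n) p) \<in> linear_maps K M MN_P.T"
    if "n \<in> carrier N" "p \<in> carrier P" for n p
    by (rule linear_maps_comp[OF bilinear_maps_left[OF tensor_bilinear that(1)]
          bilinear_maps_left[OF MN_P.tensor_bilinear that(2)]])
  note Q = MN_P.module_tensor_product
  have "(\<lambda>m y. tensor_lift K N P MN_P.T (\<lambda>n p. MN_P.t (t m n) p) y) \<in> bilinear_maps K M NP.T MN_P.T"
    \<comment> \<open>\<open>tensor_lift_bilinear\<close> puts the lifted variable first, but here
      it is the second argument; hence the swap.\<close>
    by (rule bilinear_maps_swap[OF NP.tensor_lift_bilinear[OF Q b l M.module_axioms]])
  note lift = M_NP.tensor_lift[OF Q this]
  show "tensor_assoc_inv K M N P \<in> linear_maps K M_NP.T MN_P.T"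
    unfolding tensor_assoc_inv_def Let_def by (rule lift(1))
  show "tensor_assoc_inv K M N P (M_NP.t m (NP.t n p)) = MN_P.t (t m n) p"
    if "m \<in> carrier M" "n \<in> carrier N" "p \<in> carrier P"
    unfolding tensor_assoc_inv_def Let_def
    by (simp only: lift(2)[OF that(1) NP.tensor_closed[OF that(2,3)]]
        NP.tensor_lift(2)[OF Q b[OF that(1)] that(2,3)])
qed

end

section \<open>The twistor of a Rota-Baxter system and its companion\<close>

lemma (in rota_baxter_system) weak_pseudotwistor_tensor_lift:
  "weak_pseudotwistor K A
     (tensor_lift K A A (tensor_product K A A)
        (\<lambda>a b. tensor K A A (R a) b \<oplus>\<^bsub>tensor_product K A A\<^esub> tensor K A A a (S b)))"
  (is "weak_pseudotwistor K A ?T")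
proof -
  \<comment> \<open>With all three modules equal to \<open>A\<close>, the module \<open>T\<close> is
    A \<otimes> A, while \<open>M_NP.T\<close> and \<open>MN_P.T\<close> are A \<otimes> (A
    \<otimes> A) and (A \<otimes> A) \<otimes> A. The twistor is \<open>?T\<close>, not
    \<open>T\<close>.\<close>
  interpret three_modules K A A A by unfold_locales
  define \<mu> where "\<mu> = tensor_lift K A A A (\<lambda>a b. a \<otimes>\<^bsub>A\<^esub> b)"
  define id_mu where "id_mu = tensor_map K A T A A (\<lambda>a. a) \<mu>"
  define id_T where "id_T = tensor_map K A T A T (\<lambda>a. a) ?T"
  define mu_id where "mu_id = tensor_map K T A A A \<mu> (\<lambda>a. a)"
  define T_id where "T_id = tensor_map K T A T A ?T (\<lambda>a. a)"
  \<comment> \<open>\<open>C1\<close>, \<open>C2\<close>, \<open>C3\<close> are the three summands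
    of the companion. Each is a tensor product of linear maps, so \<open>C\<close> is linear without
    any further lift.\<close>
  define C1 where "C1 = tensor_map K A T A T R (tensor_map K A A A A R (\<lambda>a. a))"
  define C2 where "C2 = tensor_map K A T A T R (tensor_map K A A A A (\<lambda>a. a) S)"
  define C3 where "C3 = tensor_map K A T A T (\<lambda>a. a) (tensor_map K A A A A S S)"
  define C where "C = (\<lambda>x. C1 x \<oplus>\<^bsub>M_NP.T\<^esub> C2 x \<oplus>\<^bsub>M_NP.T\<^esub> C3 x)"
  note ids = linear_maps_id[of K A]
  note two = two_modules_axioms
  note Rc = linear_maps_closed[OF R_linear]
  note Sc = linear_maps_closed[OF S_linear]
  have f: "(\<lambda>a b. t (R a) b \<oplus>\<^bsub>T\<^esub> t a (S b)) \<in> bilinear_maps K A A T"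
    by (intro bilinear_maps_sum module_tensor_product
        bilinear_maps_comp[OF tensor_bilinear R_linear ids]
        bilinear_maps_comp[OF tensor_bilinear ids S_linear])
  note T = tensor_lift[OF module_tensor_product f]
  note mu = tensor_lift[OF module_axioms mult_bilinear, folded \<mu>_def]
  note idmu = M_NP.tensor_map_linear[OF two ids mu(1), folded id_mu_def]
  note muid = MN_P.tensor_map_linear[OF two mu(1) ids, folded mu_id_def]
  note idT = M_NP.tensor_map_linear[OF M_NP.two_modules_axioms ids T(1), folded id_T_def]
  note Tid = MN_P.tensor_map_linear[OF MN_P.two_modules_axioms T(1) ids, folded T_id_def]
  note Ri = tensor_map_linear[OF two R_linear ids]
  note iS = tensor_map_linear[OF two ids S_linear]
  note SS = tensor_map_linear[OF two S_linear S_linear]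
  note C1 = M_NP.tensor_map_linear[OF M_NP.two_modules_axioms R_linear Ri(1), folded C1_def]
  note C2 = M_NP.tensor_map_linear[OF M_NP.two_modules_axioms R_linear iS(1), folded C2_def]
  note C3 = M_NP.tensor_map_linear[OF M_NP.two_modules_axioms ids SS(1), folded C3_def]
  note modR = M_NP.module_tensor_product
  interpret TT: module K M_NP.T by (rule modR)
  interpret TL: module K MN_P.T by (rule MN_P.module_tensor_product)
  note cl = Rc Sc tensor_closed M_NP.tensor_closed MN_P.tensor_closed mult_closed
  have C: "C \<in> linear_maps K M_NP.T M_NP.T"
    unfolding C_def by (intro linear_maps_sum modR C1(1) C2(1) C3(1))
  have Ct: "C (M_NP.t a (t b c)) = M_NP.t (R a) (t (R b) c) \<oplus>\<^bsub>M_NP.T\<^esub> M_NP.t (R a) (t b (S c))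
      \<oplus>\<^bsub>M_NP.T\<^esub> M_NP.t a (t (S b) (S c))"
    if "a \<in> carrier A" "b \<in> carrier A" "c \<in> carrier A" for a b c
    unfolding C_def using that by (simp add: C1(2) C2(2) C3(2) Ri(2) iS(2) SS(2) cl)
  note addr = linear_maps_add[OF bilinear_maps_right[OF tensor_bilinear]]
  note addl = linear_maps_add[OF bilinear_maps_left[OF tensor_bilinear]]
  \<comment> \<open>Both sides are composites of linear maps in \<open>x\<close>, so elementary
    tensors suffice.\<close>
  have "?T (id_mu (id_T x)) = id_mu (C x)" if x: "x \<in> carrier M_NP.T" for x
  proof (rule tensor_ext_right[OF linear_maps_comp[OF linear_maps_comp[OF idT(1) idmu(1)] T(1)]
        linear_maps_comp[OF C idmu(1)] module_tensor_product _ x])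
    fix a b c assume abc: "a \<in> carrier A" "b \<in> carrier A" "c \<in> carrier A"
    have "?T (id_mu (id_T (M_NP.t a (t b c)))) = ?T (t a (R b \<otimes>\<^bsub>A\<^esub> c \<oplus>\<^bsub>A\<^esub> b \<otimes>\<^bsub>A\<^esub> S c))"
      using abc by (simp add: idT(2) idmu(2) mu(2) T(2) cl linear_maps_add[OF mu(1)])
    \<comment> \<open>The twistor gives \<open>R a\<close> \<otimes> \<open>s\<close> +
      \<open>a\<close> \<otimes> \<open>S s\<close> with \<open>s = R b c + b S c\<close>. The
      Rota-Baxter identity turns \<open>S s\<close> into \<open>S b S c\<close>, and additivity in
      the right factor splits the other term.\<close>
    also have "\<dots> = t (R a) (R b \<otimes>\<^bsub>A\<^esub> c) \<oplus>\<^bsub>T\<^esub> t (R a) (b \<otimes>\<^bsub>A\<^esub> S c) \<oplus>\<^bsub>T\<^esub> t a (S b \<otimes>\<^bsub>A\<^esub> S c)"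
      using abc by (simp only: T(2) M.a_closed cl S_mult[symmetric])
        (simp add: addr cl)
    also have "\<dots> = id_mu (C (M_NP.t a (t b c)))"
      using abc by (simp add: Ct linear_maps_add[OF idmu(1)] idmu(2) mu(2) cl)
    finally show "?T (id_mu (id_T (M_NP.t a (t b c)))) = id_mu (C (M_NP.t a (t b c)))" .
  qed
  \<comment> \<open>The mirror image on (A \<otimes> A) \<otimes> A: elementary tensors pass through
    the associator to the formula for \<open>C\<close> and back.\<close>
  moreover have "?T (mu_id (T_id x)) = mu_id (tensor_assoc_inv K A A A (C (tensor_assoc K A A A x)))"
    if x: "x \<in> carrier MN_P.T" for x
  proof (rule tensor_ext_left[OF linear_maps_comp[OF linear_maps_comp[OF Tid(1) muid(1)] T(1)]
        linear_maps_comp[OF linear_maps_comp[OF linear_maps_comp[OF tensor_assoc_linear C]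
          tensor_assoc_inv_linear] muid(1)] module_tensor_product _ x])
    fix a b c assume abc: "a \<in> carrier A" "b \<in> carrier A" "c \<in> carrier A"
    have "?T (mu_id (T_id (MN_P.t (t a b) c))) = ?T (t (R a \<otimes>\<^bsub>A\<^esub> b \<oplus>\<^bsub>A\<^esub> a \<otimes>\<^bsub>A\<^esub> S b) c)"
      using abc by (simp add: Tid(2) muid(2) mu(2) T(2) cl linear_maps_add[OF mu(1)])
    \<comment> \<open>Now \<open>R (R a b + a S b)\<close> becomes \<open>R a R b\<close> in the
      first summand, and the second summand is the one that splits. The sum therefore arises
      bracketed to the right, which \<open>MN.a_assoc\<close> reconciles.\<close>
    also have "\<dots> = t (R a \<otimes>\<^bsub>A\<^esub> R b) c \<oplus>\<^bsub>T\<^esub> t (R a \<otimes>\<^bsub>A\<^esub> b) (S c) \<oplus>\<^bsub>T\<^esub> t (a \<otimes>\<^bsub>A\<^esub> S b) (S c)"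
      using abc by (simp only: T(2) M.a_closed cl R_mult[symmetric])
        (simp add: addl cl MN.a_assoc)
    also have "\<dots> = mu_id (tensor_assoc_inv K A A A (C (M_NP.t a (t b c))))"
      using abc by (simp add: Ct linear_maps_add[OF tensor_assoc_inv_linear] tensor_assoc_inv_tensor
          linear_maps_add[OF muid(1)] muid(2) mu(2) cl)
    finally show "?T (mu_id (T_id (MN_P.t (t a b) c))) =
        mu_id (tensor_assoc_inv K A A A (C (tensor_assoc K A A A (MN_P.t (t a b) c))))"
      using abc by (simp add: tensor_assoc_tensor)
  qed
  \<comment> \<open>The local maps repeat the bindings inside \<open>weak_companion\<close>, so
    after unfolding, \<open>C\<close> is the required existential witness.\<close>
  ultimately show ?thesis
    using T(1) C unfolding weak_pseudotwistor_def weak_companion_def Let_def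
      \<mu>_def id_mu_def id_T_def mu_id_def T_id_def by blast
qed

theorem lemma2p9:
  assumes "rota_baxter_system K A R S"
  shows "weak_pseudotwistor K A
           (tensor_lift K A A (tensor_product K A A)
              (\<lambda>a b. tensor K A A (R a) b \<oplus>\<^bsub>tensor_product K A A\<^esub> tensor K A A a (S b)))"
  using assms by (rule rota_baxter_system.weak_pseudotwistor_tensor_lift)

end
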